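(* Let $(a,b;c)$ be admissible hypergeometric parameters and let $D$ be the least common multiple of the denominators of $a$, $b$, $c$. Then the following are equivalent: (i) $c<a$ and $c<b$; (ii) $S(a,b;c)$ contains all but finitely many primes; (iii) $S(a,b;c)$ contains infinitely many primes $p$ with $p\equiv1\pmod D$.
   Context: $(a,b;c)$ rational is admissible if $0<a,b,c<1$ and $c\ne a$, $c\ne b$. ${}_2F_1(a,b;c;z)=\sum_{m\ge0}\frac{(a)_m(b)_m}{(c)_m}\frac{z^m}{m!}$ with $(x)_0=1$, $(x)_m=x(x+1)\cdots(x+m-1)$. $S(a,b;c)$ is the set of primes $p$ such that ${}_2F_1(a,b;c;z)$ has $p$-adically unbounded coefficients, i.e. $\inf_m v_p(A_m)=-\infty$ where $A_m$ is the $m$-th coefficient. *)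

theory Defs
  imports
    "HOL-Number_Theory.Number_Theory"
    "HOL-Computational_Algebra.Formal_Power_Series"
    "HOL-Library.Extended_Real"
begin

definition denom :: "rat \<Rightarrow> nat" where
  "denom x = nat (snd (quotient_of x))"

definition padic_val :: "nat \<Rightarrow> rat \<Rightarrow> ereal" where
  "padic_val p x =
     (if x = 0 then \<infinity>
      else ereal (real (multiplicity (int p) (fst (quotient_of x)))
                - real (multiplicity (int p) (snd (quotient_of x)))))"

definition admissible :: "rat \<Rightarrow> rat \<Rightarrow> rat \<Rightarrow> bool" where
  "admissible a b c \<longleftrightarrow>
     0 < a \<and> a < 1 \<and> 0 < b \<and> b < 1 \<and> 0 < c \<and> c < 1 \<and> c \<noteq> a \<and> c \<noteq> b"

text \<open>The last argument of \<^const>\<open>fps_hypergeo\<close> scales the variable: the series is in \<open>1 * z\<close>.\<close>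

abbreviation hypergeo_2F1 :: "rat \<Rightarrow> rat \<Rightarrow> rat \<Rightarrow> rat fps" where
  "hypergeo_2F1 a b c \<equiv> fps_hypergeo [a, b] [c] 1"

lemma hypergeo_2F1_nth:
  "fps_nth (hypergeo_2F1 a b c) m =
     pochhammer a m * pochhammer b m / pochhammer c m * (1 / fact m)"
  by simp

definition unbounded_primes :: "rat \<Rightarrow> rat \<Rightarrow> rat \<Rightarrow> nat set" where
  "unbounded_primes a b c =
     {p. prime p \<and> (INF m. padic_val p (fps_nth (hypergeo_2F1 a b c) m)) = -\<infinity>}"

end

theory Submission
  imports Defs "HOL-Computational_Algebra.Polynomial_Factorial"
begin

text \<open>
  Write \<open>a = x/D\<close>, \<open>b = y/D\<close>, \<open>c = z/D\<close>. The \<open>m\<close>-th coefficient is the product over \<open>k < m\<close> of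
  \<open>(x + kD)(y + kD) / ((z + kD)(D + kD))\<close>. For \<open>p\<close> prime to \<open>D\<close> let \<open>r\<^sub>j(x)\<close> be the residue
  in \<open>[0, p^j)\<close> with \<open>p^j | x + r\<^sub>j(x) D\<close>. Exactly \<open>m div p^j + [r\<^sub>j(x) < m mod p^j]\<close> of the numbers
  \<open>x + kD\<close> are divisible by \<open>p^j\<close>, and the bracket vanishes for \<open>x = D\<close>, so the valuation of the
  coefficient is the sum over \<open>j\<close> of
  \<open>[r\<^sub>j(x) < m mod p^j] + [r\<^sub>j(y) < m mod p^j] - [r\<^sub>j(z) < m mod p^j]\<close>.

  If \<open>p^j\<close> is \<open>1\<close> modulo \<open>D\<close>, then \<open>r\<^sub>j(x) = x (p^j - 1)/D\<close> is monotone in \<open>x\<close>. Hence for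
  \<open>p\<close> congruent to \<open>1\<close> modulo \<open>D\<close> all summands are nonnegative as soon as \<open>x \<le> z\<close> or \<open>y \<le> z\<close>.
  Conversely, if \<open>z < x\<close> and \<open>z < y\<close> and \<open>p > D\<close>, one finds \<open>m\<close> for which no summand is positive
  while the summands at \<open>j = M, 2M, \<dots>, KM\<close> equal \<open>-1\<close>, where \<open>p^M\<close> is \<open>1\<close> modulo \<open>D\<close>.
  The infinitude of the primes that are \<open>1\<close> modulo \<open>D\<close> links the last two conditions; they
  arise as prime divisors of values of an irreducible factor of \<open>X^D - 1\<close> that vanishes at a
  primitive \<open>D\<close>-th root of unity.
\<close>

subsection \<open>Primes congruent to 1\<close>

lemma poly_map_of_int_mult:
  fixes z :: "'a :: comm_ring_1"
  shows "poly (map_poly of_int (p * q)) z = poly (map_poly of_int p) z * poly (map_poly of_int q) z"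
proof -
  have add: "poly (map_poly of_int (p + q)) z = poly (map_poly of_int p) z + poly (map_poly of_int q) z"
    for p q :: "int poly"
  proof -
    have "map_poly of_int (p + q) = (map_poly of_int p + map_poly of_int q :: 'a poly)"
      by (rule poly_eqI) (simp add: coeff_map_poly)
    thus ?thesis by simp
  qed
  show ?thesis
  proof (induction p)
    case (pCons c p)
    thus ?case
      by (simp add: map_poly_pCons map_poly_smult add algebra_simps)
  qed simp
qed

text \<open>Evaluation at \<open>z\<close> is multiplicative, so in a domain a root of a product is
  a root of one of the factors. The \<open>h\<close> obtained from X^D - 1 serves below in place of
  the cyclotomic polynomial.\<close>

lemma exists_prime_factor_root:
  fixes z :: "'a :: idom" and f :: "int poly"
  assumes "f \<noteq> 0" "poly (map_poly of_int f) z = 0"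
  obtains h where "prime h" "h dvd f" "poly (map_poly of_int h) z = 0"
proof -
  have "f \<noteq> 0 \<longrightarrow> poly (map_poly of_int f) z = 0 \<longrightarrow>
          (\<exists>h. prime h \<and> h dvd f \<and> poly (map_poly of_int h) z = 0)"
  proof (induction f rule: prime_divisors_induct)
    case (unit f)
    then obtain g where "1 = f * g" by (auto elim: dvdE)
    hence "poly (map_poly of_int (f * g)) z = (1 :: 'a)" by (metis map_poly_1' of_int_1 poly_1)
    thus ?case by (auto simp: poly_map_of_int_mult)
  next
    case (factor p f)
    thus ?case by (auto simp: poly_map_of_int_mult dvd_mult)
  qed simp
  with assms that show thesis by blast
qed

lemma primitive_root_of_unity_exists:
  assumes "n > 0"
  obtains z :: complex where "z ^ n = 1" "\<And>d. 0 < d \<Longrightarrow> d < n \<Longrightarrow> z ^ d \<noteq> 1"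
proof
  let ?z = "cis (2 * pi / real n)"
  have pw: "?z ^ d = cis (2 * pi * real d / real n)" for d
    by (simp add: DeMoivre mult_ac)
  show "?z ^ n = 1" using assms by (simp add: pw)
  fix d assume d: "0 < d" "d < n"
  have "inj_on (\<lambda>k. cis (2 * pi * real k / real n)) {..<n}"
    using bij_betw_roots_unity[OF assms] by (simp add: bij_betw_def)
  from inj_onD[OF this, of d 0] d show "?z ^ d \<noteq> 1" by (auto simp: pw)
qed

text \<open>Euclid's argument: let \<open>x\<close> be a multiple of \<open>D\<close> and of all
  listed primes. A prime \<open>p\<close> dividing the value of \<open>h\<close> at \<open>x\<close>
  does not divide \<open>x\<close>, yet \<open>x\<close> has order \<open>D\<close> modulo
  \<open>p\<close>; so \<open>D\<close> divides \<open>p - 1\<close> and \<open>p\<close> would be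
  listed.\<close>

lemma infinite_primes_cong_1:
  assumes "D > 0"
  shows "infinite {p :: nat. prime p \<and> [p = 1] (mod D)}"
proof
  assume fin: "finite {p :: nat. prime p \<and> [p = 1] (mod D)}" (is "finite ?F")
  define f where "f = (monom 1 D - 1 :: int poly)"
  obtain z :: complex where z: "z ^ D = 1" "\<And>d. 0 < d \<Longrightarrow> d < D \<Longrightarrow> z ^ d \<noteq> 1"
    using primitive_root_of_unity_exists[OF assms] by blast
  have map_f: "map_poly of_int (monom 1 d - 1) = (monom 1 d - 1 :: complex poly)" for d
    by (rule poly_eqI) (simp add: coeff_map_poly)
  have "f \<noteq> 0" using assms by (auto simp: f_def monom_eq_1_iff)
  moreover have "poly (map_poly of_int f) z = 0" using z(1) by (simp add: f_def map_f poly_monom)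
  ultimately obtain h where h: "prime h" "h dvd f" "poly (map_poly of_int h) z = 0"
    by (rule exists_prime_factor_root)
  have deg_h: "degree h > 0"
  proof (rule ccontr)
    assume "\<not> degree h > 0"
    then obtain c where "h = [:c:]" by (auto elim: degree_eq_zeroE)
    with h show False by (simp add: map_poly_pCons)
  qed
  \<comment> \<open>The product excludes the listed primes, the factor \<open>D\<close> the prime
    divisors of \<open>D\<close>; the latter is what the order argument needs.\<close>
  define N where "N = D * \<Prod>?F"
  have N: "N > 0" using assms fin by (auto simp: N_def prime_gt_0_nat intro!: prod_pos)
  \<comment> \<open>Being nonconstant, \<open>h\<close> takes each of -1, 0, 1 only finitely often,
    so its value at some multiple of \<open>N\<close> has a prime divisor.\<close>
  have "finite {x. poly (h - [:u:]) x = 0}" for u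
    using deg_h by (intro poly_roots_finite) auto
  hence "finite (\<Union>u\<in>{-1,0,1}. {x. poly (h - [:u:]) x = 0})" by blast
  moreover have "infinite (range (\<lambda>n. int (N * n)))"
    using N by (intro range_inj_infinite) (auto simp: inj_on_def)
  ultimately have "\<not> range (\<lambda>n. int (N * n)) \<subseteq> (\<Union>u\<in>{-1,0,1}. {x. poly (h - [:u:]) x = 0})"
    using finite_subset by blast
  then obtain n where "int (N * n) \<notin> (\<Union>u\<in>{-1,0,1}. {x. poly (h - [:u:]) x = 0})"
    by blast
  hence n: "poly h (int (N * n)) \<notin> {-1, 0, 1}" by simp
  define x where "x = N * n"
  have "\<not> is_unit (poly h (int x))" "poly h (int x) \<noteq> 0"
    using n by (auto simp: x_def zdvd1_eq)
  then obtain p' where p': "prime p'" "p' dvd poly h (int x)"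
    using prime_divisor_exists by blast
  obtain p where "p' = int p" using zero_le_imp_eq_int[OF prime_ge_0_int[OF p'(1)]] by blast
  with p' have p: "prime p" "int p dvd poly h (int x)" by simp_all
  have "poly h (int x) dvd poly f (int x)" using h(2) by (auto elim!: dvdE)
  hence "int p dvd int x ^ D - 1" using dvd_trans[OF p(2)] by (simp add: f_def poly_monom)
  hence xD: "[x ^ D = 1] (mod p)"
    by (simp add: cong_iff_dvd_diff flip: cong_int_iff)
  hence "coprime (x ^ D) p" by (metis cong_imp_coprime cong_sym coprime_1_left)
  hence cop: "coprime p x" using assms by (simp add: coprime_commute)
  hence p_x: "\<not> p dvd x" using p(1) by (metis coprime_absorb_left not_prime_unit)
  hence p_N: "\<not> p dvd N" by (auto simp: x_def)
  have "[x ^ (p - 1) = 1] (mod p)" using p(1) p_x by (rule fermat_theorem)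
  hence ord_dvd: "ord p x dvd p - 1" by (simp add: ord_divides')
  \<comment> \<open>If the order were a proper divisor \<open>d\<close> of \<open>D\<close>, then
    \<open>h\<close> would divide (X^D - 1)/(X^d - 1), because \<open>z\<close> is not a root of X^d
    - 1. At \<open>x\<close> this quotient is congruent to \<open>e\<close> = D/d modulo
    \<open>p\<close>, so \<open>p\<close> would divide \<open>D\<close>.\<close>
  have "ord p x = D"
  proof (rule ccontr)
    define d where "d = ord p x"
    assume "ord p x \<noteq> D"
    moreover have "d dvd D" using xD by (simp add: d_def ord_divides')
    ultimately have d: "d dvd D" "0 < d" "d < D"
      using assms dvd_imp_le[of d D] by (auto simp: d_def intro: Nat.gr0I)
    then obtain e where e: "D = d * e" by (auto elim: dvdE)
    define g where "g = (\<Sum>i<e. monom 1 (d * i) :: int poly)"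
    have "f = (monom 1 d - 1) * g"
      using power_diff_1_eq[of "monom 1 d :: int poly" e]
      by (simp add: f_def g_def e monom_power)
    hence "h dvd (monom 1 d - 1) * g" using h(2) by simp
    moreover have "\<not> h dvd monom 1 d - 1"
    proof
      assume "h dvd monom 1 d - 1"
      then obtain k where "monom 1 d - 1 = h * k" by (auto elim: dvdE)
      hence "poly (map_poly of_int (monom 1 d - 1)) z = 0" using h(3)
        by (simp add: poly_map_of_int_mult)
      with z(2)[of d] d show False by (simp add: map_f poly_monom)
    qed
    ultimately have "h dvd g" using h(1) by (auto simp: prime_dvd_mult_iff)
    hence "poly h (int x) dvd poly g (int x)" by (auto elim!: dvdE)
    hence "int p dvd (\<Sum>i<e. (int x ^ d) ^ i)"
      using dvd_trans[OF p(2)] by (simp add: g_def poly_sum poly_monom power_mult)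
    moreover have "[int x ^ d = 1] (mod int p)"
      using ord[of x p] by (simp add: d_def flip: cong_int_iff)
    hence "[(\<Sum>i<e. (int x ^ d) ^ i) = (\<Sum>i<e. 1 ^ i)] (mod int p)"
      by (intro cong_sum cong_pow)
    ultimately have "p dvd e"
      by (simp add: cong_dvd_iff)
    hence "p dvd N" by (simp add: N_def e)
    with p_N show False ..
  qed
  with ord_dvd have "[p = 1] (mod D)"
    using prime_ge_1_nat[OF p(1)] by (simp add: cong_altdef_nat)
  hence "p dvd \<Prod>?F" using p(1) fin by (intro dvd_prodI) auto
  hence "p dvd N" by (simp add: N_def)
  with p_N show False ..
qed

subsection \<open>Divisibility by prime powers in arithmetic progressions\<close>

lemma multiplicity_eq_card_powers:
  fixes p n :: nat
  assumes "prime p" "0 < n" "n < p ^ J"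
  shows "multiplicity p n = card {j \<in> {1..J}. p ^ j dvd n}"
proof -
  have "p ^ multiplicity p n \<le> n"
    using assms(2) by (intro dvd_imp_le multiplicity_dvd)
  also note assms(3)
  finally have "multiplicity p n < J"
    using prime_gt_1_nat[OF assms(1)] by simp
  hence "{j \<in> {1..J}. p ^ j dvd n} = {1..multiplicity p n}"
    using assms prime_gt_1_nat[OF assms(1)] by (auto simp: power_dvd_iff_le_multiplicity)
  thus ?thesis by simp
qed

definition hit_count :: "nat \<Rightarrow> nat \<Rightarrow> nat \<Rightarrow> nat \<Rightarrow> nat" where
  "hit_count P D x m = card {k. k < m \<and> P dvd x + k * D}"

lemma multiplicity_prod_progression:
  fixes p :: nat
  assumes "prime p" "0 < x" "x + m * D < p ^ J"
  shows "multiplicity p (\<Prod>k<m. x + k * D) = (\<Sum>j\<in>{1..J}. hit_count (p ^ j) D x m)"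
proof -
  have "multiplicity p (\<Prod>k<m. x + k * D) = (\<Sum>k<m. multiplicity p (x + k * D))"
    using assms by (intro prime_elem_multiplicity_prod_distrib) auto
  also have "\<dots> = (\<Sum>k<m. \<Sum>j\<in>{1..J}. of_bool (p ^ j dvd x + k * D))"
  proof (rule sum.cong)
    fix k assume "k \<in> {..<m}"
    hence "x + k * D < p ^ J"
      by (intro le_less_trans[OF _ assms(3)]) auto
    with assms have "multiplicity p (x + k * D) = card {j \<in> {1..J}. p ^ j dvd x + k * D}"
      by (intro multiplicity_eq_card_powers) auto
    thus "multiplicity p (x + k * D) = (\<Sum>j\<in>{1..J}. of_bool (p ^ j dvd x + k * D))"
      by (simp add: Int_def)
  qed simp
  also have "\<dots> = (\<Sum>j\<in>{1..J}. \<Sum>k<m. of_bool (p ^ j dvd x + k * D))"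
    by (rule sum.swap)
  also have "\<dots> = (\<Sum>j\<in>{1..J}. hit_count (p ^ j) D x m)"
    by (simp add: hit_count_def Int_def)
  finally show ?thesis .
qed

lemma dvd_progression_iff:
  fixes P D x r k :: nat
  assumes "coprime P D" "r < P" "P dvd x + r * D"
  shows "P dvd x + k * D \<longleftrightarrow> k mod P = r"
proof -
  have "P dvd x + k * D \<longleftrightarrow> [x + k * D = x + r * D] (mod P)"
    using assms(3) by (metis cong_0_iff cong_dvd_iff cong_sym cong_trans)
  also have "\<dots> \<longleftrightarrow> [k = r] (mod P)"
    using assms(1) by (simp add: cong_add_lcancel_nat cong_mult_rcancel_nat coprime_commute)
  also have "\<dots> \<longleftrightarrow> k mod P = r" using assms(2) by (simp add: cong_def)
  finally show ?thesis .
qed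

lemma hit_count_eq:
  assumes "coprime P D" "r < P" "P dvd x + r * D"
  shows "hit_count P D x m = m div P + of_bool (r < m mod P)"
proof -
  have "card {k. k < m \<and> k mod P = r} = m div P + of_bool (r < m mod P)"
  proof (induction m)
    case (Suc m)
    have "{k. k < Suc m \<and> k mod P = r} =
      (if m mod P = r then insert m else id) {k. k < m \<and> k mod P = r}"
      by (auto simp: less_Suc_eq)
    hence "card {k. k < Suc m \<and> k mod P = r} =
      card {k. k < m \<and> k mod P = r} + of_bool (m mod P = r)" by simp
    also have "\<dots> = Suc m div P + of_bool (r < Suc m mod P)"
      using assms(2) mod_less_divisor[of P m]
      by (auto simp: Suc.IH div_Suc mod_Suc)
    finally show ?case .
  qed simp
  thus ?thesis by (simp add: hit_count_def dvd_progression_iff[OF assms])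
qed

lemma residue_exists:
  fixes P D x :: nat
  assumes "coprime P D" "P > 0"
  obtains r where "r < P" "P dvd x + r * D"
proof -
  obtain u where u: "[D * u = 1] (mod P)"
    using cong_solve_coprime_nat[of D P] assms(1) by (auto simp: coprime_commute)
  \<comment> \<open>With \<open>P - 1\<close> in the role of -1, this is the residue of
    -x/D.\<close>
  define r where "r = (u * (P - 1) * x) mod P"
  have "[r = u * (P - 1) * x] (mod P)" by (simp add: r_def)
  hence "[x + r * D = x + (u * (P - 1) * x) * D] (mod P)"
    by (intro cong_add cong_mult cong_refl)
  also have "x + (u * (P - 1) * x) * D = x + (D * u) * ((P - 1) * x)"
    by (simp add: mult_ac)
  also have "[x + (D * u) * ((P - 1) * x) = x + 1 * ((P - 1) * x)] (mod P)"
    by (intro cong_add cong_mult u cong_refl)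
  also have "x + 1 * ((P - 1) * x) = P * x"
    using assms(2) by (cases P) simp_all
  finally have "P dvd x + r * D" by (simp add: cong_dvd_iff)
  moreover have "r < P" using assms(2) by (simp add: r_def)
  ultimately show thesis using that by blast
qed

lemma hit_count_ge:
  assumes "coprime P D" "P > 0"
  shows "hit_count P D x m \<ge> m div P"
proof -
  obtain r where "r < P" "P dvd x + r * D" using residue_exists assms by blast
  thus ?thesis using hit_count_eq[OF assms(1)] by simp
qed

text \<open>The first multiple of \<open>P\<close> occurs at \<open>k = P - 1\<close>, the last
  index of a full block, so an incomplete block contributes nothing.\<close>

lemma hit_count_same:
  assumes "coprime P D" "P > 0"
  shows "hit_count P D D m = m div P"
proof -
  have "D + (P - 1) * D = P * D" using assms(2) by (cases P) auto
  hence "hit_count P D D m = m div P + of_bool (P - 1 < m mod P)"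
    using assms by (intro hit_count_eq) auto
  moreover have "\<not> P - 1 < m mod P" using mod_less_divisor[OF assms(2), of m] by linarith
  ultimately show ?thesis by simp
qed

lemma cong_1_imp_coprime:
  fixes P D :: nat
  assumes "[P = 1] (mod D)"
  shows "coprime P D"
  using assms by (metis cong_imp_coprime cong_sym coprime_1_left)

lemma residue_cong_1:
  fixes P D x :: nat
  assumes "[P = 1] (mod D)" "P > 0" "0 < x" "x \<le> D"
  shows "(P - 1) div D * x < P" "P dvd x + (P - 1) div D * x * D"
proof -
  have "D dvd P - 1" using assms by (simp add: cong_altdef_nat)
  hence E: "(P - 1) div D * D = P - 1" by simp
  have "(P - 1) div D * x \<le> (P - 1) div D * D" using assms(4) by (rule mult_le_mono2)
  with E assms(2) show "(P - 1) div D * x < P" by linarith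
  have "x + (P - 1) div D * x * D = x + (P - 1) * x"
    using arg_cong[OF E, of "\<lambda>t. t * x"] by (simp add: mult_ac)
  also have "\<dots> = P * x" using assms(2) by (cases P) auto
  finally show "P dvd x + (P - 1) div D * x * D" by simp
qed

lemma hit_count_cong_1:
  assumes "[P = 1] (mod D)" "P > 0" "0 < x" "x \<le> D"
  shows "hit_count P D x m = m div P + of_bool ((P - 1) div D * x < m mod P)"
  using assms by (intro hit_count_eq residue_cong_1 cong_1_imp_coprime)

text \<open>Treats moduli \<open>P\<close> that need not be 1 modulo \<open>D\<close>: the unknown
  residue for \<open>P\<close> reduces modulo \<open>P'\<close> to the explicit one, hence is at
  least as large.\<close>

lemma hit_count_eq_div:
  assumes "coprime P D" "P > 0" "P' dvd P" "[P' = 1] (mod D)" "0 < x" "x \<le> D"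
    and "m mod P \<le> (P' - 1) div D * x"
  shows "hit_count P D x m = m div P"
proof -
  obtain r where r: "r < P" "P dvd x + r * D" using residue_exists assms by blast
  have "P' > 0" using assms(2,3) by (auto intro: Nat.gr0I)
  moreover have "P' dvd x + r * D" using r(2) assms(3) by (rule dvd_trans[rotated])
  ultimately have "r mod P' = (P' - 1) div D * x"
    using dvd_progression_iff[OF cong_1_imp_coprime[OF assms(4)]
        residue_cong_1[OF assms(4) _ assms(5,6)], of r]
    by simp
  hence "m mod P \<le> r" using assms(7) mod_less_eq_dividend[of r P'] by linarith
  thus ?thesis using hit_count_eq[OF assms(1) r, of m] by simp
qed

subsection \<open>Valuations of hypergeometric coefficients\<close>

lemma padic_val_divide:
  assumes "prime p" "n > 0" "d > 0"
  shows "padic_val p (of_nat n / of_nat d) = ereal (real (multiplicity p n) - real (multiplicity p d))"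
proof -
  obtain u w where q: "quotient_of (of_nat n / of_nat d) = (u, w)" by (meson surj_pair)
  have w: "w > 0" using quotient_of_denom_pos[OF q] .
  have eq: "(of_nat n / of_nat d :: rat) = of_int u / of_int w" using quotient_of_div[OF q] .
  hence "(of_int (int n * w) :: rat) = of_int (u * int d)"
    using assms w by (simp add: field_simps)
  hence eq': "int n * w = u * int d" by (simp only: of_int_eq_iff)
  have u: "u \<noteq> 0" using eq' assms w by auto
  have p: "prime_elem (int p)" using assms(1) by simp
  have "multiplicity (int p) (int n) + multiplicity (int p) w =
    multiplicity (int p) u + multiplicity (int p) (int d)"
    using arg_cong[OF eq', of "multiplicity (int p)"] assms w u
    by (simp add: prime_elem_multiplicity_mult_distrib[OF p])
  moreover have "multiplicity (int p) (int k) = multiplicity p k" for k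
    by (simp add: multiplicity_def flip: of_nat_power)
  ultimately show ?thesis
    using assms by (simp add: padic_val_def q)
qed

lemma pochhammer_divide_of_nat:
  assumes "D > 0"
  shows "pochhammer (of_nat x / of_nat D :: rat) m = of_nat (\<Prod>k<m. x + k * D) / of_nat D ^ m"
  using assms
  by (induction m) (simp_all add: pochhammer_Suc field_simps)

lemma hypergeo_2F1_nth_eq:
  assumes "D > 0"
  shows "fps_nth (hypergeo_2F1 (of_nat x / of_nat D) (of_nat y / of_nat D) (of_nat z / of_nat D)) m =
    of_nat ((\<Prod>k<m. x + k * D) * (\<Prod>k<m. y + k * D)) /
    of_nat ((\<Prod>k<m. z + k * D) * (\<Prod>k<m. D + k * D))"
proof -
  \<comment> \<open>The factorial is the Pochhammer symbol at 1 = D/D, so all four factors have the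
    same shape and the powers of \<open>D\<close> cancel.\<close>
  have "(fact m :: rat) = of_nat (\<Prod>k<m. D + k * D) / of_nat D ^ m"
    using pochhammer_divide_of_nat[OF assms, of D m] assms
    by (simp add: pochhammer_fact)
  thus ?thesis
    unfolding hypergeo_2F1_nth using assms
    by (simp add: pochhammer_divide_of_nat)
qed

lemma padic_val_hypergeo_nth:
  assumes "prime p" "D > 0" "x > 0" "y > 0" "z > 0"
  assumes "x + m * D < p ^ J" "y + m * D < p ^ J" "z + m * D < p ^ J" "D + m * D < p ^ J"
  shows "padic_val p (fps_nth (hypergeo_2F1 (of_nat x / of_nat D) (of_nat y / of_nat D)
                                            (of_nat z / of_nat D)) m) =
    ereal (real (\<Sum>j\<in>{1..J}. hit_count (p ^ j) D x m + hit_count (p ^ j) D y m) -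
           real (\<Sum>j\<in>{1..J}. hit_count (p ^ j) D z m + hit_count (p ^ j) D D m))"
proof -
  have p: "prime_elem p" using assms(1) by simp
  have nz: "(\<Prod>k<m. u + k * D) > 0" if "u > 0" for u using that by (intro prod_pos) auto
  show ?thesis
    unfolding hypergeo_2F1_nth_eq[OF assms(2)]
    using assms nz
    by (subst padic_val_divide)
       (simp_all add: prime_elem_multiplicity_mult_distrib[OF p]
          multiplicity_prod_progression[of p _ _ _ J] sum.distrib)
qed

text \<open>For each power of \<open>p\<close>, the hits of \<open>z\<close> are bounded by those of
  \<open>x\<close>, and the hits of \<open>D\<close>, being minimal, by those of
  \<open>y\<close>.\<close>

lemma padic_val_hypergeo_nonneg:
  assumes p: "prime p" "[p = 1] (mod D)"
    and "0 < x" "x \<le> z" "z \<le> D" "0 < y"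
  shows "padic_val p (fps_nth (hypergeo_2F1 (of_nat x / of_nat D) (of_nat y / of_nat D)
                                            (of_nat z / of_nat D)) m) \<ge> 0"
proof -
  define J where "J = x + y + z + D + m * D"
  have J: "J < p ^ J" using prime_gt_1_nat[OF p(1)] by (intro power_gt_expt) simp
  have "hit_count (p ^ j) D z m + hit_count (p ^ j) D D m
      \<le> hit_count (p ^ j) D x m + hit_count (p ^ j) D y m" for j
  proof -
    have pos: "p ^ j > 0" using p(1) by (simp add: prime_gt_0_nat)
    have pj: "[p ^ j = 1] (mod D)" using cong_pow[OF p(2), of j] by simp
    have cop: "coprime (p ^ j) D" using cong_1_imp_coprime[OF pj] .
    have le: "(p ^ j - 1) div D * x \<le> (p ^ j - 1) div D * z" using assms by simp
    have "hit_count (p ^ j) D z m \<le> hit_count (p ^ j) D x m"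
      using assms pos
      by (auto simp: hit_count_cong_1[OF pj] simp del: One_nat_def intro: le_less_trans[OF le])
    moreover have "hit_count (p ^ j) D D m \<le> hit_count (p ^ j) D y m"
      using hit_count_ge[OF cop pos] by (simp add: hit_count_same[OF cop pos])
    ultimately show ?thesis by simp
  qed
  hence "(\<Sum>j\<in>{1..J}. hit_count (p ^ j) D z m + hit_count (p ^ j) D D m)
      \<le> (\<Sum>j\<in>{1..J}. hit_count (p ^ j) D x m + hit_count (p ^ j) D y m)"
    by (intro sum_mono)
  moreover have "padic_val p (fps_nth (hypergeo_2F1 (of_nat x / of_nat D) (of_nat y / of_nat D)
                                            (of_nat z / of_nat D)) m) =
    ereal (real (\<Sum>j\<in>{1..J}. hit_count (p ^ j) D x m + hit_count (p ^ j) D y m) -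
           real (\<Sum>j\<in>{1..J}. hit_count (p ^ j) D z m + hit_count (p ^ j) D D m))"
    using assms J by (intro padic_val_hypergeo_nth) (auto simp: J_def)
  ultimately show ?thesis by (simp del: of_nat_sum of_nat_add)
qed

lemma padic_val_hypergeo_unbounded:
  assumes p: "prime p" "D < p" and "0 < z" "z < x" "z < y" "x \<le> D" "y \<le> D"
  shows "\<exists>m. padic_val p (fps_nth (hypergeo_2F1 (of_nat x / of_nat D) (of_nat y / of_nat D)
                                            (of_nat z / of_nat D)) m) \<le> ereal (- real K)"
proof -
  have D: "D > 0" using assms by simp
  \<comment> \<open>\<open>m0\<close> is the least multiple of \<open>p ^ (M - 1)\<close> above the residue \<open>E * z\<close>; because \<open>D < p\<close> it does
      not exceed \<open>E * x\<close> and \<open>E * y\<close>. In base \<open>Q\<close>, \<open>m\<close> consists of \<open>K\<close> digits equal to \<open>m0\<close>.\<close>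
  define M where "M = totient D"
  define Q where "Q = p ^ M"
  define E where "E = (Q - 1) div D"
  define T where "T = p ^ (M - 1)"
  define G where "G k = (\<Sum>i<k. Q ^ i)" for k
  define m0 where "m0 = (E * z div T + 1) * T"
  define m where "m = m0 * G K"
  have M: "M > 0" using D by (simp add: M_def)
  have p1: "p > 1" using p(1) by (rule prime_gt_1_nat)
  have "\<not> p dvd D" using p(2) D by (auto dest: dvd_imp_le)
  hence cop: "coprime p D" using p(1) by (simp add: prime_imp_coprime)
  have Q1: "[Q = 1] (mod D)" using euler_theorem[OF cop] by (simp add: Q_def M_def)
  have Qpos: "Q > 0" "T > 0" using p1 by (auto simp: Q_def T_def)
  have "D dvd Q - 1" using Q1 Qpos by (simp add: cong_altdef_nat)
  hence E: "E * D = Q - 1" by (simp add: E_def)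
  have Gmult: "(Q - 1) * G k = Q ^ k - 1" for k
    using power_diff_1_eq[of "int Q" k] Qpos
    by (simp add: G_def of_nat_diff flip: of_nat_eq_iff[where ?'a = int])
  \<comment> \<open>\<open>G k\<close> is the number with \<open>k\<close> digits 1 in base
    \<open>Q\<close>. Hence the residue of \<open>u \<le> D\<close> modulo \<open>Q ^ k\<close> has
    all digits equal to \<open>E * u\<close>, to be compared with the digit \<open>m0\<close> of
    \<open>m\<close>.\<close>
  have EG: "(Q ^ k - 1) div D = E * G k" for k
    unfolding Gmult[symmetric] E[symmetric] using D by simp
  have Gmono: "G k \<le> G l" if "k \<le> l" for k l
    unfolding G_def using that by (intro sum_mono2) auto
  have Qk: "[Q ^ k = 1] (mod D)" for k using cong_pow[OF Q1, of k] by simp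
  \<comment> \<open>The gap from \<open>E * z\<close> to \<open>E * (z + 1)\<close> must be wide
    enough for a multiple of \<open>T\<close>. From \<open>D < p\<close> one gets
    \<open>Q = p * T \<ge> (D + 1) * T\<close>, while \<open>Q = E * D + 1\<close>.\<close>
  have TE: "T \<le> E"
  proof (rule ccontr)
    assume "\<not> T \<le> E"
    hence "(E + 1) * D \<le> T * D" by (intro mult_le_mono1) simp
    moreover have "Q = p * T" using M by (simp add: Q_def T_def flip: power_Suc)
    hence "(D + 1) * T \<le> Q" using p(2) by (simp del: mult_Suc)
    ultimately show False using E D Qpos by (simp add: algebra_simps)
  qed
  have m0_gt: "m0 > E * z"
    using Qpos(2) by (simp add: m0_def) (metis dividend_less_div_times mult.commute)
  have m0_le: "m0 \<le> E * u" if "z < u" for u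
  proof -
    have "m0 \<le> E * z + T" by (simp add: m0_def)
    also have "\<dots> \<le> E * (z + 1)" using TE by simp
    also have "\<dots> \<le> E * u" using that by (intro mult_le_mono2) simp
    finally show ?thesis .
  qed
  have m0_Q: "m0 \<le> Q - 1"
    using m0_le[OF \<open>z < x\<close>] mult_le_mono2[OF \<open>x \<le> D\<close>, of E] E by simp
  have G_add: "G (k + l) = G k + Q ^ k * G l" for k l
    by (induction l) (simp_all add: G_def power_add algebra_simps)
  have m_split: "m = m0 * G k + Q ^ k * m0 * G (K - k)" if "k \<le> K" for k
    using G_add[of k "K - k"] that by (simp add: m_def algebra_simps)
  \<comment> \<open>The residue for \<open>p ^ j\<close> is controlled through the largest power of
    \<open>Q\<close> dividing it, namely \<open>Q ^ k\<close> with
    \<open>k = j div M\<close>.\<close>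
  have numer: "hit_count (p ^ j) D u m = m div p ^ j" if u: "z < u" "u \<le> D" for u j
  proof (rule hit_count_eq_div)
    define k where "k = j div M"
    define i where "i = j mod M"
    have j: "j = M * k + i" by (simp add: k_def i_def)
    show "Q ^ k dvd p ^ j" by (simp add: j Q_def power_add power_mult)
    \<comment> \<open>The base-\<open>p\<close> digits of \<open>m\<close> at the positions \<open>M * k, \<dots>, M * k + M - 2\<close> vanish, so truncating
        at \<open>p ^ j\<close> gives the same as truncating at \<open>Q ^ k\<close>.\<close>
    have "m mod p ^ j \<le> m0 * G k"
    proof (cases "k \<le> K")
      case True
      have "i \<le> M - 1" using mod_less_divisor[OF M, of j] by (simp add: i_def)
      hence "p ^ i dvd m0" by (simp add: m0_def T_def le_imp_power_dvd)
      hence "p ^ j dvd Q ^ k * m0 * G (K - k)"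
        by (simp add: j Q_def power_add power_mult mult_dvd_mono)
      hence "m mod p ^ j = (m0 * G k) mod p ^ j"
        unfolding m_split[OF True] by (metis add.commute mod_add_self2 mod_mult_self2 dvdE)
      thus ?thesis by simp
    next
      case False
      have "m mod p ^ j \<le> m" by simp
      also have "m \<le> m0 * G k" unfolding m_def using False by (intro mult_le_mono2 Gmono) simp
      finally show ?thesis .
    qed
    also have "\<dots> \<le> E * u * G k" by (intro mult_le_mono1 m0_le u)
    finally show "m mod p ^ j \<le> (Q ^ k - 1) div D * u" by (simp add: EG mult_ac del: One_nat_def)
  qed (use cop p1 u Qk in auto)
  \<comment> \<open>At \<open>j = M * k\<close> with \<open>1 \<le> k \<le> K\<close>, the
    truncation \<open>m0 * G k\<close> of \<open>m\<close> exceeds the residue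
    \<open>E * z * G k\<close>, which gives one extra hit.\<close>
  have denom: "hit_count (p ^ j) D z m \<ge> m div p ^ j + of_bool (j \<in> (*) M ` {1..K})" for j
  proof (cases "j \<in> (*) M ` {1..K}")
    case False
    thus ?thesis using hit_count_ge[of "p ^ j" D m z] cop p1 by simp
  next
    case True
    then obtain k where k: "k \<in> {1..K}" "j = M * k" by blast
    have pj: "p ^ j = Q ^ k" by (simp add: k Q_def power_mult)
    have "m0 * G k \<le> Q ^ k - 1" using mult_le_mono1[OF m0_Q, of "G k"] by (simp only: Gmult)
    moreover have "Q ^ k > 0" using Qpos by simp
    ultimately have lt: "m0 * G k < Q ^ k" by linarith
    have "m mod Q ^ k = (m0 * G k) mod Q ^ k"
      using k by (subst m_split[of k]) (auto simp: mult.assoc)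
    also have "\<dots> = m0 * G k" using lt by simp
    finally have mm: "m mod Q ^ k = m0 * G k" .
    have "G k \<ge> G 1" using k by (intro Gmono) auto
    hence "G k > 0" by (simp add: G_def)
    hence "E * z * G k < m0 * G k" using m0_gt by simp
    hence "(Q ^ k - 1) div D * z < m mod Q ^ k" by (simp add: EG mm mult_ac del: One_nat_def)
    thus ?thesis using hit_count_cong_1[OF Qk[of k], of z m] Qpos assms by (simp add: pj del: One_nat_def)
  qed
  \<comment> \<open>The summand \<open>M * K\<close> brings all the exponents with an extra hit into
    \<open>{1..J}\<close>; the others put the progressions below \<open>p ^ J\<close>.\<close>
  define J where "J = x + y + z + D + m * D + M * K"
  have J: "J < p ^ J" using p1 by (intro power_gt_expt) simp
  have "(\<Sum>j\<in>{1..J}. hit_count (p ^ j) D x m + hit_count (p ^ j) D y m) + K =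
      (\<Sum>j\<in>{1..J}. 2 * (m div p ^ j)) + card ((*) M ` {1..K})"
    using M assms by (simp add: numer card_image inj_on_def mult_2)
  also have "(*) M ` {1..K} = {1..J} \<inter> (*) M ` {1..K}"
    using M by (auto simp: J_def intro!: trans_le_add2)
  also have "card \<dots> = (\<Sum>j\<in>{1..J}. of_bool (j \<in> (*) M ` {1..K}))"
    by simp
  also have "(\<Sum>j\<in>{1..J}. 2 * (m div p ^ j)) + \<dots> =
      (\<Sum>j\<in>{1..J}. m div p ^ j + of_bool (j \<in> (*) M ` {1..K}) + m div p ^ j)"
    unfolding sum.distrib[symmetric] by (intro sum.cong) auto
  also have "\<dots> \<le> (\<Sum>j\<in>{1..J}. hit_count (p ^ j) D z m + hit_count (p ^ j) D D m)"
    using hit_count_ge[of _ D m D] cop p1 by (intro sum_mono add_mono denom) auto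
  finally have le: "(\<Sum>j\<in>{1..J}. hit_count (p ^ j) D x m + hit_count (p ^ j) D y m) + K
      \<le> (\<Sum>j\<in>{1..J}. hit_count (p ^ j) D z m + hit_count (p ^ j) D D m)" .
  have "padic_val p (fps_nth (hypergeo_2F1 (of_nat x / of_nat D) (of_nat y / of_nat D)
                                            (of_nat z / of_nat D)) m) =
    ereal (real (\<Sum>j\<in>{1..J}. hit_count (p ^ j) D x m + hit_count (p ^ j) D y m) -
           real (\<Sum>j\<in>{1..J}. hit_count (p ^ j) D z m + hit_count (p ^ j) D D m))"
    using assms J D by (intro padic_val_hypergeo_nth) (auto simp: J_def)
  also have "\<dots> \<le> ereal (- real K)"
    using of_nat_mono[OF le, where ?'a = real] by (simp del: of_nat_sum)
  finally show ?thesis by blast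
qed

section \<open>Common denominators and the cycle of implications\<close>

lemma denom_dvd_imp_numerator_exists:
  assumes "denom a dvd D" "D > 0" "a > 0"
  obtains x where "a = of_nat x / of_nat D"
proof -
  obtain u w where q: "quotient_of a = (u, w)" by (meson surj_pair)
  have w: "w > 0" using quotient_of_denom_pos[OF q] .
  have a: "a = of_int u / of_int w" using quotient_of_div[OF q] .
  have u: "u > 0" using assms(3) w by (simp add: a zero_less_divide_iff)
  obtain e where e: "D = nat w * e" using assms(1) by (auto simp: denom_def q)
  have "(of_nat (nat u * e) :: rat) / of_nat D = a"
    using assms(2) u w by (simp add: a e field_simps of_nat_nat)
  thus thesis using that by metis
qed

theorem theorem4p12:
  fixes a b c :: rat and D :: nat
  assumes "admissible a b c"
    and "D = lcm (denom a) (lcm (denom b) (denom c))"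
  shows "(c < a \<and> c < b \<longleftrightarrow> finite {p. prime p \<and> p \<notin> unbounded_primes a b c})
       \<and> (finite {p. prime p \<and> p \<notin> unbounded_primes a b c}
            \<longleftrightarrow> infinite {p \<in> unbounded_primes a b c. [p = 1] (mod D)})"
proof -
  have "denom q > 0" for q
    using quotient_of_denom_pos'[of q] by (simp add: denom_def)
  hence D: "D > 0" by (simp add: assms(2) lcm_pos_nat)
  have adm: "0 < a" "a < 1" "0 < b" "b < 1" "0 < c" "c < 1" "c \<noteq> a" "c \<noteq> b"
    using assms(1) by (auto simp: admissible_def)
  obtain x y z where xyz: "a = of_nat x / of_nat D" "b = of_nat y / of_nat D" "c = of_nat z / of_nat D"
    using denom_dvd_imp_numerator_exists[of a D] denom_dvd_imp_numerator_exists[of b D] denom_dvd_imp_numerator_exists[of c D] D adm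
    by (metis assms(2) dvd_lcm1 dvd_lcm2 dvd_trans)
  have ord: "0 < x" "x < D" "0 < y" "y < D" "0 < z" "z < D" "c < a \<longleftrightarrow> z < x" "c < b \<longleftrightarrow> z < y"
    using adm D by (auto simp: xyz field_simps)
  have 1: "finite {p. prime p \<and> p \<notin> unbounded_primes a b c}" if "c < a" "c < b"
  proof (rule finite_subset)
    show "{p. prime p \<and> p \<notin> unbounded_primes a b c} \<subseteq> {..D}"
    proof (rule subsetI, rule ccontr)
      fix p assume "p \<in> {p. prime p \<and> p \<notin> unbounded_primes a b c}" "p \<notin> {..D}"
      hence p: "prime p" "p \<notin> unbounded_primes a b c" and "D < p" by simp_all
      have zxy: "z < x" "z < y" using that ord by simp_all
      have "(INF m. padic_val p (fps_nth (hypergeo_2F1 a b c) m)) = -\<infinity>"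
      proof (rule ereal_bot)
        fix B :: real
        obtain K where K: "- B \<le> real K" using real_arch_simple by blast
        obtain m where "padic_val p (fps_nth (hypergeo_2F1 a b c) m) \<le> ereal (- real K)"
          using padic_val_hypergeo_unbounded[of p D z x y K] p(1) \<open>D < p\<close> zxy ord(2,4,5)
          unfolding xyz by (blast intro: less_imp_le)
        moreover have "ereal (- real K) \<le> ereal B" using K by simp
        ultimately show "(INF m. padic_val p (fps_nth (hypergeo_2F1 a b c) m)) \<le> ereal B"
          by (meson INF_lower2 UNIV_I order_trans)
      qed
      with p show False by (simp add: unbounded_primes_def)
    qed
  qed simp
  have 2: "infinite {p \<in> unbounded_primes a b c. [p = 1] (mod D)}"
    if fin: "finite {p. prime p \<and> p \<notin> unbounded_primes a b c}"
  proof
    assume "finite {p \<in> unbounded_primes a b c. [p = 1] (mod D)}"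
    hence "finite ({p \<in> unbounded_primes a b c. [p = 1] (mod D)} \<union>
             {p. prime p \<and> p \<notin> unbounded_primes a b c})" using fin by blast
    hence "finite {p :: nat. prime p \<and> [p = 1] (mod D)}" by (rule rev_finite_subset) auto
    with infinite_primes_cong_1[OF D] show False by blast
  qed
  \<comment> \<open>One prime of the infinite set suffices: otherwise all its valuations are
    nonnegative, by symmetry in \<open>a\<close> and \<open>b\<close> also when only
    \<open>y \<le> z\<close> holds.\<close>
  have 3: "c < a \<and> c < b" if inf: "infinite {p \<in> unbounded_primes a b c. [p = 1] (mod D)}"
  proof (rule ccontr)
    assume "\<not> (c < a \<and> c < b)"
    hence le: "x \<le> z \<or> y \<le> z" using ord by auto
    obtain p where "p \<in> unbounded_primes a b c" and p1: "[p = 1] (mod D)"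
      using infinite_imp_nonempty[OF inf] by blast
    hence p: "prime p" "(INF m. padic_val p (fps_nth (hypergeo_2F1 a b c) m)) = -\<infinity>"
      by (auto simp: unbounded_primes_def)
    have "padic_val p (fps_nth (hypergeo_2F1 a b c) m) \<ge> 0" for m
    proof (cases "x \<le> z")
      case True
      thus ?thesis unfolding xyz using ord p1 p(1) by (intro padic_val_hypergeo_nonneg) auto
    next
      case False
      have "fps_nth (hypergeo_2F1 a b c) m = fps_nth (hypergeo_2F1 b a c) m"
        unfolding hypergeo_2F1_nth by (simp only: mult.commute)
      moreover have "padic_val p (fps_nth (hypergeo_2F1 b a c) m) \<ge> 0"
        unfolding xyz using False le ord p1 p(1) by (intro padic_val_hypergeo_nonneg) auto
      ultimately show ?thesis by (simp only:)
    qed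
    hence "(INF m. padic_val p (fps_nth (hypergeo_2F1 a b c) m)) \<ge> 0" by (intro INF_greatest)
    with p(2) show False by simp
  qed
  from 1 2 3 show ?thesis by blast
qed

end
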